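(* Let $L$ be an alternating link, let $\overline{A}_B$ (resp. $\overline{A}_W$) be the weighted adjacency matrix of the graph $G_B^*$ (resp. $G_W^*$) of a reduced alternating diagram of $L$, and let $A_B$ (resp. $A_W$) be the corresponding (unweighted) adjacency matrix. Then $$CWR_2(L)=\left(\tfrac12\,\mathrm{trace}(\overline{A}_B\cdot A_B),\;\tfrac12\,\mathrm{trace}(\overline{A}_W\cdot A_W)\right),$$ $$CWR_3(L)=\left(\tfrac16\,\mathrm{trace}(\overline{A}_B^{\,3}),\;\tfrac16\,\mathrm{trace}(\overline{A}_W^{\,3})\right).$$
   Context: The weighted adjacency matrix $\overline{A}(G)$ of an edge-weighted simple graph $G$ without loops, with vertices $v_1,\dots,v_m$ in some fixed order, is the symmetric matrix with $\overline{A}_{i,j}(G)$ equal to the weight of $e$ if $v_i,v_j$ are the endpoints of an edge $e$, and $0$ otherwise. The adjacency matrix $A(G)$ is the same matrix with all edge weights replaced by $1$. Links are oriented links in $\mathbb{R}^3$ (for a knot, the choice of orientation does not affect anything below). A link diagram is alternating if, travelling along each component, over- and under-crossings alternate. A crossing is nugatory if some circle in the projection plane meets the diagram transversally only at that crossing point. A diagram is reduced if it has no nugatory crossing and its underlying projection is connected. Alternating links here are those admitting a reduced alternating diagram in this sense. Let $D$ be a reduced alternating diagram of an alternating link $L$. Its regions are the faces of the underlying 4-valent plane graph (including the unbounded face). Checkerboard shading: at each crossing, the two opposite regions swept out when the over-strand is rotated counterclockwise until it meets the under-strand are of type $A$ at that crossing. In a reduced alternating diagram a region is of type $A$ at all of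 its crossings or at none of them; regions of type $A$ are called black, the others white. The graph $G_B$ has one vertex per black region and one edge per crossing, joining the two black regions that meet at that crossing; $G_W$ is defined in the same way with white regions. Each edge gets weight $w$ if its crossing is positive and $r$ if its crossing is negative (standard crossing sign: with both strands oriented upward, the crossing is positive if the over-strand runs from bottom left to top right). The simple graph $G_B^*$ is obtained from $G_B$ by replacing all edges between the same pair of vertices by one edge whose weight is the product of the weights of the replaced edges; $G_W^*$ is obtained from $G_W$ in the same way. Write $wg(e)$ for the weight of an edge $e$. Define $CB_2(w,r)=\sum_{e}wg(e)$, the sum over all edges $e$ of $G_B^*$ ($0$ if there are no edges, as for the trivial knot), and $CB_3(w,r)=\sum_{C}\prod_{e\in C}wg(e)\in\mathbb{Z}[w,r]$, the sum over all unoriented cycles (simple closed paths) $C$ of length $3$ in $G_B^*$ ($0$ if there are none). Define $CW_2(w,r)$, $CW_3(w,r)$ in the same way from $G_W^*$. Put $CWR_i(L)=(CB_i(w,r),CW_i(w,r))$ for $i=2,3$. This does not depend on the choice of reduced alternating diagram $D$ of $L$. *)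

theory Defs
  imports
    "HOL-Analysis.Analysis"
    "HOL-Computational_Algebra.Polynomial"
    "Jordan_Normal_Form.Matrix"
begin

section \<open>Weighted graphs and their adjacency matrices\<close>

record ('v, 'e, 'k) multigraph =
  mverts :: "'v set"
  medges :: "'e set"
  mends :: "'e \<Rightarrow> 'v set"
  mweight :: "'e \<Rightarrow> 'k"

text \<open>An edge of a simple graph is the two-element set of its endpoints.\<close>

record ('v, 'k) simple_graph =
  verts :: "'v set"
  edges :: "'v set set"
  weight :: "'v set \<Rightarrow> 'k"

text \<open>All edges between the same two vertices are merged into one, whose weight is the product of
  theirs.  The simple graph underlying a multigraph has no loops; the graphs \<open>black_graph\<close> and
  \<open>white_graph\<close> below have none to begin with when the diagram is reduced and alternating, since
  a region that occupies two opposite corners of a crossing makes this crossing nugatory.\<close>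

definition merge_parallel ::
    "('v, 'e, 'k::comm_monoid_mult) multigraph \<Rightarrow> ('v, 'k) simple_graph" where
  "merge_parallel G =
     \<lparr> verts = mverts G,
       edges = {e. card e = 2 \<and> (\<exists>c\<in>medges G. mends G c = e)},
       weight = (\<lambda>e. \<Prod>c\<in>{c\<in>medges G. mends G c = e}. mweight G c) \<rparr>"

definition triangles :: "('v, 'k) simple_graph \<Rightarrow> 'v set set set" where
  "triangles G = {C. C \<subseteq> edges G \<and>
     (\<exists>x y z. x \<noteq> y \<and> y \<noteq> z \<and> z \<noteq> x \<and> C = {{x, y}, {y, z}, {z, x}})}"

definition edge_sum :: "('v, 'k::comm_semiring_1) simple_graph \<Rightarrow> 'k" where
  "edge_sum G = (\<Sum>e\<in>edges G. weight G e)"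

definition triangle_sum :: "('v, 'k::comm_semiring_1) simple_graph \<Rightarrow> 'k" where
  "triangle_sum G = (\<Sum>C\<in>triangles G. \<Prod>e\<in>C. weight G e)"

text \<open>The list \<open>vs\<close> enumerates the vertices.\<close>

definition weighted_adjacency_matrix ::
    "'v list \<Rightarrow> ('v, 'k::comm_semiring_1) simple_graph \<Rightarrow> 'k mat" where
  "weighted_adjacency_matrix vs G =
     mat (length vs) (length vs)
       (\<lambda>(i, j). if {vs ! i, vs ! j} \<in> edges G then weight G {vs ! i, vs ! j} else 0)"

definition adjacency_matrix ::
    "'v list \<Rightarrow> ('v, 'k::comm_semiring_1) simple_graph \<Rightarrow> 'k mat" where
  "adjacency_matrix vs G = weighted_adjacency_matrix vs (G\<lparr>weight := (\<lambda>_. 1)\<rparr>)"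

definition mat_trace :: "'k::comm_monoid_add mat \<Rightarrow> 'k" where
  "mat_trace A = (\<Sum>i<dim_row A. A $$ (i, i))"


section \<open>Links\<close>

text \<open>A closed curve is a \<open>1\<close>-periodic function on the reals; it is oriented by its
  parameter.  Continuous differentiability with nowhere vanishing derivative makes embedded
  curves tame.\<close>

definition simple_closed_C1_curve :: "(real \<Rightarrow> 'a::real_normed_vector) \<Rightarrow> bool" where
  "simple_closed_C1_curve \<gamma> \<longleftrightarrow>
     \<gamma> C1_differentiable_on UNIV \<and>
     (\<forall>t. vector_derivative \<gamma> (at t) \<noteq> 0) \<and>
     (\<forall>t. \<gamma> (t + 1) = \<gamma> t) \<and>
     inj_on \<gamma> {0..<1}"

text \<open>Three-space is the product of the projection plane and the height axis, which points
  towards the viewer.  A link is given by the list of its components.\<close>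

type_synonym space = "complex \<times> real"

type_synonym link = "(real \<Rightarrow> space) list"

definition is_link :: "link \<Rightarrow> bool" where
  "is_link L \<longleftrightarrow>
     L \<noteq> [] \<and>
     (\<forall>i<length L. simple_closed_C1_curve (L ! i)) \<and>
     (\<forall>i<length L. \<forall>j<length L. i \<noteq> j \<longrightarrow> range (L ! i) \<inter> range (L ! j) = {})"

text \<open>Ambient isotopy of oriented links: the end of the isotopy carries the components of \<open>L\<close> to
  those of \<open>L'\<close>, up to their numbering and orientation preserving reparametrisations \<open>\<phi> i\<close> of
  the circle \<open>\<real>/\<int>\<close>.\<close>

definition link_equivalent :: "link \<Rightarrow> link \<Rightarrow> bool" where
  "link_equivalent L L' \<longleftrightarrow>
     (\<exists>H :: real \<Rightarrow> space \<Rightarrow> space.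
        continuous_on ({0..1} \<times> UNIV) (\<lambda>(t, x). H t x) \<and>
        (\<forall>t\<in>{0..1}. \<exists>g. homeomorphism UNIV UNIV (H t) g) \<and>
        H 0 = id \<and>
        (\<exists>\<sigma> (\<phi> :: nat \<Rightarrow> real \<Rightarrow> real).
           bij_betw \<sigma> {..<length L} {..<length L'} \<and>
           (\<forall>i<length L.
              continuous_on UNIV (\<phi> i) \<and> strict_mono (\<phi> i) \<and>
              (\<forall>t. \<phi> i (t + 1) = \<phi> i t + 1) \<and>
              H 1 \<circ> (L ! i) = (L' ! \<sigma> i) \<circ> \<phi> i)))"


section \<open>Link diagrams\<close>

text \<open>A diagram is a link in general position with respect to the projection \<open>fst\<close>.  A point of
  the link is addressed by a component number and a parameter in \<open>{0..<1}\<close>.\<close>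

definition shadow :: "link \<Rightarrow> complex set" where
  "shadow D = (\<Union>i<length D. range (\<lambda>t. fst ((D ! i) t)))"

definition strands :: "link \<Rightarrow> complex \<Rightarrow> (nat \<times> real) set" where
  "strands D p = {(i, t). i < length D \<and> 0 \<le> t \<and> t < 1 \<and> fst ((D ! i) t) = p}"

fun height :: "link \<Rightarrow> nat \<times> real \<Rightarrow> real" where
  "height D (i, t) = snd ((D ! i) t)"

fun velocity :: "link \<Rightarrow> nat \<times> real \<Rightarrow> complex" where
  "velocity D (i, t) = vector_derivative (\<lambda>x. fst ((D ! i) x)) (at t)"

text \<open>The determinant of two plane vectors: positive iff the direction of \<open>v\<close> is obtained from
  that of \<open>u\<close> by a counterclockwise rotation through an angle strictly between \<open>0\<close> and \<open>\<pi>\<close>.\<close>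

definition det2 :: "complex \<Rightarrow> complex \<Rightarrow> real" where
  "det2 u v = Im (cnj u * v)"

definition crossings :: "link \<Rightarrow> complex set" where
  "crossings D = {p. \<exists>a\<in>strands D p. \<exists>b\<in>strands D p. a \<noteq> b}"

definition is_diagram :: "link \<Rightarrow> bool" where
  "is_diagram D \<longleftrightarrow>
     is_link D \<and>
     (\<forall>i<length D. \<forall>t. velocity D (i, t) \<noteq> 0) \<and>
     finite (crossings D) \<and>
     (\<forall>p\<in>crossings D.
        card (strands D p) = 2 \<and>
        (\<forall>a\<in>strands D p. \<forall>b\<in>strands D p. a \<noteq> b \<longrightarrow> det2 (velocity D a) (velocity D b) \<noteq> 0))"

definition over_strand :: "link \<Rightarrow> complex \<Rightarrow> nat \<times> real" where
  "over_strand D p = (THE a. a \<in> strands D p \<and> (\<forall>b\<in>strands D p. b \<noteq> a \<longrightarrow> height D b < height D a))"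

definition under_strand :: "link \<Rightarrow> complex \<Rightarrow> nat \<times> real" where
  "under_strand D p = (THE a. a \<in> strands D p \<and> (\<forall>b\<in>strands D p. b \<noteq> a \<longrightarrow> height D a < height D b))"

abbreviation over_dir :: "link \<Rightarrow> complex \<Rightarrow> complex" where
  "over_dir D p \<equiv> velocity D (over_strand D p)"

abbreviation under_dir :: "link \<Rightarrow> complex \<Rightarrow> complex" where
  "under_dir D p \<equiv> velocity D (under_strand D p)"

definition positive_crossing :: "link \<Rightarrow> complex \<Rightarrow> bool" where
  "positive_crossing D p \<longleftrightarrow> det2 (over_dir D p) (under_dir D p) > 0"

text \<open>The parameter runs over all reals, so that also the last crossing passed in a period and the
  first one passed in the next period count as consecutive.\<close>

definition passes_crossing :: "link \<Rightarrow> nat \<Rightarrow> real \<Rightarrow> bool" where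
  "passes_crossing D i t \<longleftrightarrow> fst ((D ! i) t) \<in> crossings D"

definition passes_over :: "link \<Rightarrow> nat \<Rightarrow> real \<Rightarrow> bool" where
  "passes_over D i t \<longleftrightarrow> over_strand D (fst ((D ! i) t)) = (i, frac t)"

definition alternating_diagram :: "link \<Rightarrow> bool" where
  "alternating_diagram D \<longleftrightarrow>
     (\<forall>i<length D. \<forall>s t.
        s < t \<and> passes_crossing D i s \<and> passes_crossing D i t \<and>
        (\<forall>x. s < x \<and> x < t \<longrightarrow> \<not> passes_crossing D i x) \<longrightarrow>
        (passes_over D i s \<longleftrightarrow> \<not> passes_over D i t))"

text \<open>Transversality of the circle \<open>J\<close> at the crossing: its tangent is not parallel to any of
  the two strands.\<close>

definition nugatory :: "link \<Rightarrow> complex \<Rightarrow> bool" where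
  "nugatory D p \<longleftrightarrow>
     (\<exists>J :: real \<Rightarrow> complex. \<exists>t.
        simple_closed_C1_curve J \<and> range J \<inter> shadow D = {p} \<and> J t = p \<and>
        (\<forall>a\<in>strands D p. det2 (vector_derivative J (at t)) (velocity D a) \<noteq> 0))"

definition reduced_diagram :: "link \<Rightarrow> bool" where
  "reduced_diagram D \<longleftrightarrow> (\<forall>p\<in>crossings D. \<not> nugatory D p) \<and> connected (shadow D)"

definition reduced_alternating_diagram_of :: "link \<Rightarrow> link \<Rightarrow> bool" where
  "reduced_alternating_diagram_of D L \<longleftrightarrow>
     is_diagram D \<and> alternating_diagram D \<and> reduced_diagram D \<and> link_equivalent D L"

definition alternating_link :: "link \<Rightarrow> bool" where
  "alternating_link L \<longleftrightarrow> is_link L \<and> (\<exists>D. reduced_alternating_diagram_of D L)"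


section \<open>Checkerboard shading and the graphs of a diagram\<close>

definition regions :: "link \<Rightarrow> complex set set" where
  "regions D = components (- shadow D)"

definition crossings_of_region :: "link \<Rightarrow> complex set \<Rightarrow> complex set" where
  "crossings_of_region D R = {p\<in>crossings D. p \<in> closure R}"

text \<open>The directions that either end of the over-strand takes while it is rotated counterclockwise
  about the crossing, strictly before it first becomes parallel to the under-strand.\<close>

definition swept_directions :: "link \<Rightarrow> complex \<Rightarrow> complex set" where
  "swept_directions D p =
     {s * cis \<theta> * over_dir D p | s \<theta>. s \<in> {1, -1} \<and> 0 < \<theta> \<and>
        (\<forall>\<phi>\<in>{0<..\<theta>}. det2 (cis \<phi> * over_dir D p) (under_dir D p) \<noteq> 0)}"

text \<open>A region is swept out at \<open>p\<close> if it contains an initial piece of a ray from \<open>p\<close> in a swept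
  direction.  Near a crossing the diagram consists of two transversal arcs, so all rays inside
  the same corner start in the same region.\<close>

definition type_A_at :: "link \<Rightarrow> complex set \<Rightarrow> complex \<Rightarrow> bool" where
  "type_A_at D R p \<longleftrightarrow>
     (\<exists>d\<in>swept_directions D p. \<forall>\<^sub>F x in at_right 0. p + complex_of_real x * d \<in> R)"

text \<open>In a diagram without crossings both regions count as black; its graphs have no edges under
  any convention.\<close>

definition black_regions :: "link \<Rightarrow> complex set set" where
  "black_regions D = {R\<in>regions D. \<forall>p\<in>crossings_of_region D R. type_A_at D R p}"

definition white_regions :: "link \<Rightarrow> complex set set" where
  "white_regions D = regions D - black_regions D"

text \<open>The polynomial ring \<open>\<int>[w, r]\<close> is represented as \<open>(\<int>[w])[r]\<close>.\<close>

definition w_var :: "int poly poly" where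
  "w_var = [: [:0, 1:] :]"

definition r_var :: "int poly poly" where
  "r_var = [:0, 1:]"

definition crossing_weight :: "link \<Rightarrow> complex \<Rightarrow> int poly poly" where
  "crossing_weight D p = (if positive_crossing D p then w_var else r_var)"

definition region_graph ::
    "complex set set \<Rightarrow> link \<Rightarrow> (complex set, complex, int poly poly) multigraph" where
  "region_graph V D =
     \<lparr> mverts = V,
       medges = crossings D,
       mends = (\<lambda>p. {R\<in>V. p \<in> crossings_of_region D R}),
       mweight = crossing_weight D \<rparr>"

definition black_graph :: "link \<Rightarrow> (complex set, complex, int poly poly) multigraph" where
  "black_graph D = region_graph (black_regions D) D"

definition white_graph :: "link \<Rightarrow> (complex set, complex, int poly poly) multigraph" where
  "white_graph D = region_graph (white_regions D) D"

definition black_simple_graph :: "link \<Rightarrow> (complex set, int poly poly) simple_graph" where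
  "black_simple_graph D = merge_parallel (black_graph D)"

definition white_simple_graph :: "link \<Rightarrow> (complex set, int poly poly) simple_graph" where
  "white_simple_graph D = merge_parallel (white_graph D)"


section \<open>The invariants\<close>

definition CWR2_diagram :: "link \<Rightarrow> int poly poly \<times> int poly poly" where
  "CWR2_diagram D = (edge_sum (black_simple_graph D), edge_sum (white_simple_graph D))"

definition CWR3_diagram :: "link \<Rightarrow> int poly poly \<times> int poly poly" where
  "CWR3_diagram D = (triangle_sum (black_simple_graph D), triangle_sum (white_simple_graph D))"

text \<open>The invariants of a link are read off from some reduced alternating diagram of it; that the
  choice does not matter is the predicate \<open>CWR_diagram_independent\<close>.\<close>

definition CWR2 :: "link \<Rightarrow> int poly poly \<times> int poly poly" where
  "CWR2 L = CWR2_diagram (SOME D. reduced_alternating_diagram_of D L)"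

definition CWR3 :: "link \<Rightarrow> int poly poly \<times> int poly poly" where
  "CWR3 L = CWR3_diagram (SOME D. reduced_alternating_diagram_of D L)"

definition CWR_diagram_independent :: "link \<Rightarrow> bool" where
  "CWR_diagram_independent L \<longleftrightarrow>
     (\<forall>D D'. reduced_alternating_diagram_of D L \<and> reduced_alternating_diagram_of D' L \<longrightarrow>
        CWR2_diagram D = CWR2_diagram D' \<and> CWR3_diagram D = CWR3_diagram D')"

text \<open>The inclusion of \<open>\<int>[w, r]\<close> in \<open>\<rat>[w, r]\<close>, where the traces are divided by \<open>2\<close> and \<open>6\<close>.\<close>

definition rat_of_int_poly2 :: "int poly poly \<Rightarrow> rat poly poly" where
  "rat_of_int_poly2 = map_poly (map_poly rat_of_int)"

definition rat_scale :: "rat \<Rightarrow> int poly poly \<Rightarrow> rat poly poly" where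
  "rat_scale q f = [:[:q:]:] * rat_of_int_poly2 f"

end

theory Submission
  imports Defs
begin

text \<open>The trace of a product of two or three adjacency matrices sums the products of edge weights
  over the closed walks of length two or three.  In a graph without loops, such a walk of length
  two runs to and fro along an edge, so that each edge is counted twice, and one of length three
  runs around a triangle, with three starting points and two directions.\<close>

text \<open>Matrix entries are indexed here by vertices instead of positions in a list, so that the
  traces become sums over the vertex set, free of the chosen enumeration.\<close>

definition adjacency_weight :: "('v, 'k::comm_semiring_1) simple_graph \<Rightarrow> 'v \<Rightarrow> 'v \<Rightarrow> 'k" where
  "adjacency_weight G x y = (if {x, y} \<in> edges G then weight G {x, y} else 0)"

lemma dim_weighted_adjacency_matrix [simp]:
  "dim_row (weighted_adjacency_matrix vs G) = length vs"
  "dim_col (weighted_adjacency_matrix vs G) = length vs"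
  by (simp_all add: weighted_adjacency_matrix_def)

lemma index_weighted_adjacency_matrix [simp]:
  "i < length vs \<Longrightarrow> j < length vs \<Longrightarrow>
     weighted_adjacency_matrix vs G $$ (i, j) = adjacency_weight G (vs ! i) (vs ! j)"
  by (simp add: weighted_adjacency_matrix_def adjacency_weight_def)

lemma sum_nth_distinct:
  assumes "distinct vs"
  shows "(\<Sum>i<length vs. f (vs ! i)) = (\<Sum>x\<in>set vs. f x)"
  using sum.reindex_bij_betw[OF bij_betw_nth[OF assms refl refl]] .

lemma mat_trace_weighted_adjacency_mult:
  assumes "distinct vs"
  shows "mat_trace (weighted_adjacency_matrix vs G * weighted_adjacency_matrix vs H) =
    (\<Sum>x\<in>set vs. \<Sum>y\<in>set vs. adjacency_weight G x y * adjacency_weight H y x)"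
proof -
  have "mat_trace (weighted_adjacency_matrix vs G * weighted_adjacency_matrix vs H) =
    (\<Sum>i<length vs. \<Sum>j<length vs.
       adjacency_weight G (vs ! i) (vs ! j) * adjacency_weight H (vs ! j) (vs ! i))"
    by (simp add: mat_trace_def scalar_prod_def lessThan_atLeast0)
  then show ?thesis
    by (simp add: sum_nth_distinct[OF assms, of "\<lambda>y. adjacency_weight G z y * adjacency_weight H y z" for z]
        sum_nth_distinct[OF assms, of "\<lambda>x. \<Sum>y\<in>set vs. adjacency_weight G x y * adjacency_weight H y x"])
qed

text \<open>The walk is \<open>x\<close>, \<open>y\<close>, \<open>z\<close>, \<open>x\<close>. The
  sum over \<open>y\<close> stands innermost because \<open>y\<close> is the inner index of the
  square of the matrix, which is then multiplied by the third factor.\<close>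

lemma mat_trace_weighted_adjacency_cube:
  assumes "distinct vs"
  shows "mat_trace (weighted_adjacency_matrix vs G ^\<^sub>m 3) =
    (\<Sum>x\<in>set vs. \<Sum>z\<in>set vs. \<Sum>y\<in>set vs.
       adjacency_weight G x y * adjacency_weight G y z * adjacency_weight G z x)"
proof -
  let ?a = "adjacency_weight G"
  let ?W = "weighted_adjacency_matrix vs G"
  have "mat_trace (?W ^\<^sub>m 3) = mat_trace (?W * ?W * ?W)"
    by (simp add: numeral_3_eq_3)
  also have "\<dots> = (\<Sum>i<length vs. \<Sum>k<length vs. \<Sum>j<length vs.
      ?a (vs ! i) (vs ! j) * ?a (vs ! j) (vs ! k) * ?a (vs ! k) (vs ! i))"
    by (simp add: mat_trace_def scalar_prod_def lessThan_atLeast0 sum_distrib_right)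
  \<comment> \<open>Positions are replaced by vertices from the innermost sum outwards, the vertices
    of the outer sums being parameters.\<close>
  finally show ?thesis
    by (simp add: sum_nth_distinct[OF assms, of "\<lambda>y. ?a u y * ?a y v * ?a v u" for u v]
        sum_nth_distinct[OF assms, of "\<lambda>z. \<Sum>y\<in>set vs. ?a u y * ?a y z * ?a z u" for u]
        sum_nth_distinct[OF assms, of "\<lambda>x. \<Sum>z\<in>set vs. \<Sum>y\<in>set vs. ?a x y * ?a y z * ?a z x"])
qed

text \<open>The trace is a sum over ordered pairs of adjacent vertices. Sending a pair to its edge
  has fibres of size two, since an edge has two distinct ends.\<close>

lemma mat_trace_weighted_adjacency_mult_adjacency:
  fixes G :: "('v, 'k::comm_semiring_1) simple_graph"
  assumes "distinct vs" and edges: "\<And>e. e \<in> edges G \<Longrightarrow> card e = 2 \<and> e \<subseteq> set vs"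
  shows "mat_trace (weighted_adjacency_matrix vs G * adjacency_matrix vs G) = of_nat 2 * edge_sum G"
proof -
  define V where "V = set vs"
  have finV: "finite V" by (simp add: V_def)
  define S where "S = {u \<in> V \<times> V. {fst u, snd u} \<in> edges G}"
  have finS: "finite S" using finV by (simp add: S_def)
  have "edges G \<subseteq> Pow V" using edges unfolding V_def by blast
  then have finE: "finite (edges G)" using finV by (blast intro: finite_subset)
  have fibre: "card {u \<in> S. {fst u, snd u} = e} = 2" if e: "e \<in> edges G" for e
  proof -
    obtain x y where xy: "e = {x, y}" "x \<noteq> y"
      using edges[OF e] by (auto simp: card_2_iff)
    then have "{u \<in> S. {fst u, snd u} = e} = {(x, y), (y, x)}"
      using e edges[OF e] by (auto simp: S_def V_def doubleton_eq_iff insert_commute)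
    then show ?thesis using xy by simp
  qed
  \<comment> \<open>The step back along the edge contributes the factor 1, so the weight occurs once
    and is not squared.\<close>
  have "mat_trace (weighted_adjacency_matrix vs G * adjacency_matrix vs G) =
      (\<Sum>x\<in>V. \<Sum>y\<in>V. if {x, y} \<in> edges G then weight G {x, y} else 0)"
    unfolding adjacency_matrix_def mat_trace_weighted_adjacency_mult[OF assms(1)] V_def
    by (auto intro!: sum.cong simp: adjacency_weight_def insert_commute)
  also have "\<dots> = (\<Sum>u\<in>S. weight G {fst u, snd u})"
    using finV by (simp add: sum.cartesian_product case_prod_unfold S_def sum.inter_filter)
  also have "\<dots> = (\<Sum>e\<in>edges G. \<Sum>u | u \<in> S \<and> {fst u, snd u} = e. weight G {fst u, snd u})"
    by (rule sum.group[symmetric]) (use finS finE in \<open>auto simp: S_def\<close>)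
  also have "\<dots> = (\<Sum>e\<in>edges G. \<Sum>u | u \<in> S \<and> {fst u, snd u} = e. weight G e)"
    by (intro sum.cong) auto
  also have "\<dots> = of_nat 2 * edge_sum G"
    using fibre by (simp add: edge_sum_def sum_distrib_left)
  finally show ?thesis .
qed

text \<open>A triangle is encoded as the set of its sides; a product over this set has three factors
  only if no two sides coincide.\<close>

lemma triangle_sides_distinct:
  assumes "x \<noteq> y" "y \<noteq> z" "z \<noteq> x"
  shows "{x, y} \<noteq> {y, z}" "{y, z} \<noteq> {z, x}" "{x, y} \<noteq> {z, x}"
  using assms by (auto simp: doubleton_eq_iff)

lemma mat_trace_weighted_adjacency_cube_eq_triangle_sum:
  fixes G :: "('v, 'k::comm_semiring_1) simple_graph"
  assumes "distinct vs" and edges: "\<And>e. e \<in> edges G \<Longrightarrow> card e = 2 \<and> e \<subseteq> set vs"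
  shows "mat_trace (weighted_adjacency_matrix vs G ^\<^sub>m 3) = of_nat 6 * triangle_sum G"
proof -
  define V where "V = set vs"
  have finV: "finite V" by (simp add: V_def)
  \<comment> \<open>The triple lists the vertices in the order in which the sums of the trace are
    nested, with the middle vertex of the walk last.\<close>
  define sides :: "'v \<times> 'v \<times> 'v \<Rightarrow> 'v set set" where
    "sides = (\<lambda>(x, z, y). {{x, y}, {y, z}, {z, x}})"
  define S where "S = {u \<in> V \<times> V \<times> V. sides u \<subseteq> edges G}"
  have finS: "finite S" using finV by (simp add: S_def)
  have "edges G \<subseteq> Pow V" using edges unfolding V_def by blast
  then have finE: "finite (edges G)" using finV by (blast intro: finite_subset)
  have finT: "finite (triangles G)"
    using finE by (auto intro!: finite_subset[of "triangles G" "Pow (edges G)"] simp: triangles_def)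
  \<comment> \<open>There are no loops: \<open>{x, x}\<close> has only one element.\<close>
  have neq: "x \<noteq> y" if "{x, y} \<in> edges G" for x y
    using edges[OF that] by auto
  have sides_S: "sides ` S \<subseteq> triangles G"
  proof
    fix C assume "C \<in> sides ` S"
    then obtain x y z where C: "C = {{x, y}, {y, z}, {z, x}}" "C \<subseteq> edges G"
      by (auto simp: S_def sides_def)
    moreover from C have "x \<noteq> y" "y \<noteq> z" "z \<noteq> x" by (auto dest: neq)
    ultimately show "C \<in> triangles G" unfolding triangles_def by blast
  qed
  have fibre: "card {u \<in> S. sides u = C} = 6" if C: "C \<in> triangles G" for C
  proof -
    obtain x y z where xyz: "x \<noteq> y" "y \<noteq> z" "z \<noteq> x" "C = {{x, y}, {y, z}, {z, x}}"
      and sub: "C \<subseteq> edges G"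
      using C by (auto simp: triangles_def)
    have V: "x \<in> V" "y \<in> V" "z \<in> V"
      using xyz(4) sub edges[of "{x, y}"] edges[of "{y, z}"] by (auto simp: V_def)
    \<comment> \<open>The union of the sides recovers the vertex set, so a triple in the fibre
      consists of three distinct elements of \<open>{x, y, z}\<close>, which leaves the six
      orderings.\<close>
    have triples: "u \<in> {(x, y, z), (x, z, y), (y, x, z), (y, z, x), (z, x, y), (z, y, x)}"
      if u: "u \<in> S" "sides u = C" for u
    proof -
      obtain a b c where abc: "u = (a, b, c)" by (cases u)
      have "\<Union> (sides u) = {a, b, c}" "\<Union> C = {x, y, z}"
        by (auto simp: abc sides_def xyz(4))
      then have "{a, b, c} = {x, y, z}" using u by simp
      moreover have "a \<noteq> c" "c \<noteq> b" "b \<noteq> a"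
        using u by (auto simp: S_def abc sides_def dest: neq)
      ultimately have "a \<in> {x, y, z}" "b \<in> {x, y, z}" "c \<in> {x, y, z}" "a \<noteq> c" "c \<noteq> b" "b \<noteq> a"
        by blast+
      then show ?thesis unfolding abc by auto
    qed
    have sides_base: "sides (x, z, y) = {{x, y}, {y, z}, {z, x}}"
      by (simp add: sides_def)
    \<comment> \<open>These two transpositions generate all permutations of the three entries, so
      every ordering yields the same triangle.\<close>
    have sides_swap: "sides (a, b, c) = sides (b, a, c)" "sides (a, b, c) = sides (a, c, b)"
      for a b c
      by (auto simp: sides_def doubleton_eq_iff)
    have "sides (x, y, z) = C" "sides (x, z, y) = C" "sides (y, x, z) = C"
        "sides (y, z, x) = C" "sides (z, x, y) = C" "sides (z, y, x) = C"
      using xyz(4) by (metis sides_base sides_swap)+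
    then have "{(x, y, z), (x, z, y), (y, x, z), (y, z, x), (z, x, y), (z, y, x)} \<subseteq> {u \<in> S. sides u = C}"
      using V sub by (simp add: S_def)
    with triples have "{u \<in> S. sides u = C} =
        {(x, y, z), (x, z, y), (y, x, z), (y, z, x), (z, x, y), (z, y, x)}"
      by blast
    then show ?thesis using xyz by simp
  qed
  have weights: "(\<Prod>e\<in>sides (x, z, y). weight G e) =
      weight G {x, y} * weight G {y, z} * weight G {z, x}" if "sides (x, z, y) \<subseteq> edges G" for x y z
  proof -
    have "x \<noteq> y" "y \<noteq> z" "z \<noteq> x" using that by (auto simp: sides_def dest: neq)
    from triangle_sides_distinct[OF this] show ?thesis by (simp add: sides_def mult.assoc)
  qed
  \<comment> \<open>If a side is missing, one of the three factors vanishes, so only the triples in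
    \<open>S\<close> contribute to the trace.\<close>
  have walk: "adjacency_weight G x y * adjacency_weight G y z * adjacency_weight G z x =
      (if sides (x, z, y) \<subseteq> edges G then (\<Prod>e\<in>sides (x, z, y). weight G e) else 0)" for x y z
  proof (cases "sides (x, z, y) \<subseteq> edges G")
    case True
    then show ?thesis unfolding weights[OF True] by (simp add: adjacency_weight_def sides_def)
  qed (auto simp: adjacency_weight_def sides_def)
  have "mat_trace (weighted_adjacency_matrix vs G ^\<^sub>m 3) =
      (\<Sum>x\<in>V. \<Sum>z\<in>V. \<Sum>y\<in>V. if sides (x, z, y) \<subseteq> edges G then (\<Prod>e\<in>sides (x, z, y). weight G e) else 0)"
    unfolding mat_trace_weighted_adjacency_cube[OF assms(1)] V_def
    by (intro sum.cong refl) (simp add: walk)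
  also have "\<dots> = (\<Sum>u\<in>S. \<Prod>e\<in>sides u. weight G e)"
    using finV by (simp add: sum.cartesian_product case_prod_unfold S_def sum.inter_filter cong: if_cong)
  also have "\<dots> = (\<Sum>C\<in>triangles G. \<Sum>u | u \<in> S \<and> sides u = C. \<Prod>e\<in>sides u. weight G e)"
    by (rule sum.group[symmetric, OF finS finT sides_S])
  also have "\<dots> = (\<Sum>C\<in>triangles G. \<Sum>u | u \<in> S \<and> sides u = C. \<Prod>e\<in>C. weight G e)"
    by (intro sum.cong) auto
  also have "\<dots> = of_nat 6 * triangle_sum G"
    using fibre by (simp add: triangle_sum_def sum_distrib_left)
  finally show ?thesis .
qed

text \<open>The traces have integer coefficients, and the division takes place only after the
  inclusion in the rational polynomials, where the factor \<open>n\<close> cancels in each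
  coefficient.\<close>

lemma rat_scale_of_nat_mult:
  assumes "n \<noteq> 0"
  shows "rat_scale (1 / of_nat n) (of_nat n * f) = rat_of_int_poly2 f"
  using assms
  by (intro poly_eqI) (simp add: rat_scale_def rat_of_int_poly2_def coeff_map_poly of_nat_poly)

text \<open>Supplies the hypothesis on edges of both trace formulas: \<open>merge_parallel\<close>
  keeps only end sets of size two, and the ends of a crossing are taken from
  \<open>V\<close>.\<close>

lemma edges_merge_region_graph:
  "e \<in> edges (merge_parallel (region_graph V D)) \<Longrightarrow> card e = 2 \<and> e \<subseteq> V"
  by (auto simp: merge_parallel_def region_graph_def)

text \<open>Treats both colours at once: \<open>V\<close> will be the set of black regions and then
  that of white ones.\<close>

lemma region_graph_trace_formulas:
  fixes vs :: "complex set list" and D :: link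
  assumes "distinct vs" and "set vs = V"
  defines "G \<equiv> merge_parallel (region_graph V D)"
  shows "rat_scale (1/2) (mat_trace (weighted_adjacency_matrix vs G * adjacency_matrix vs G)) =
      rat_of_int_poly2 (edge_sum G)"
    and "rat_scale (1/6) (mat_trace (weighted_adjacency_matrix vs G ^\<^sub>m 3)) =
      rat_of_int_poly2 (triangle_sum G)"
proof -
  have edges: "card e = 2 \<and> e \<subseteq> set vs" if "e \<in> edges G" for e
    using edges_merge_region_graph that assms by blast
  show "rat_scale (1/2) (mat_trace (weighted_adjacency_matrix vs G * adjacency_matrix vs G)) =
      rat_of_int_poly2 (edge_sum G)"
    using rat_scale_of_nat_mult[of 2]
    by (subst mat_trace_weighted_adjacency_mult_adjacency[OF assms(1)]) (use edges in blast, simp)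
  show "rat_scale (1/6) (mat_trace (weighted_adjacency_matrix vs G ^\<^sub>m 3)) =
      rat_of_int_poly2 (triangle_sum G)"
    using rat_scale_of_nat_mult[of 6]
    by (subst mat_trace_weighted_adjacency_cube_eq_triangle_sum[OF assms(1)]) (use edges in blast, simp)
qed

theorem proposition3p5:
  fixes L D :: link and bs ws :: "complex set list"
  assumes "alternating_link L"
    and "reduced_alternating_diagram_of D L"
    and "distinct bs" and "set bs = black_regions D"
    and "distinct ws" and "set ws = white_regions D"
  shows
    "let WB = weighted_adjacency_matrix bs (black_simple_graph D);
         WW = weighted_adjacency_matrix ws (white_simple_graph D);
         AB = adjacency_matrix bs (black_simple_graph D);
         AW = adjacency_matrix ws (white_simple_graph D);
         T2 = (rat_scale (1/2) (mat_trace (WB * AB)), rat_scale (1/2) (mat_trace (WW * AW)));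
         T3 = (rat_scale (1/6) (mat_trace (WB ^\<^sub>m 3)), rat_scale (1/6) (mat_trace (WW ^\<^sub>m 3)))
     in map_prod rat_of_int_poly2 rat_of_int_poly2 (CWR2_diagram D) = T2 \<and>
        map_prod rat_of_int_poly2 rat_of_int_poly2 (CWR3_diagram D) = T3 \<and>
        (CWR_diagram_independent L \<longrightarrow>
           map_prod rat_of_int_poly2 rat_of_int_poly2 (CWR2 L) = T2 \<and>
           map_prod rat_of_int_poly2 rat_of_int_poly2 (CWR3 L) = T3)"
proof -
  \<comment> \<open>Since \<open>D\<close> is a candidate, the diagram chosen in \<open>CWR2\<close>
    and \<open>CWR3\<close> is a reduced alternating diagram of \<open>L\<close> too, and
    independence carries its values over to \<open>D\<close>.\<close>
  have "reduced_alternating_diagram_of (SOME D'. reduced_alternating_diagram_of D' L) L"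
    using assms(2) by (rule someI)
  then have "CWR2 L = CWR2_diagram D \<and> CWR3 L = CWR3_diagram D" if "CWR_diagram_independent L"
    using that assms(2) unfolding CWR_diagram_independent_def CWR2_def CWR3_def by blast
  then show ?thesis
    using region_graph_trace_formulas[OF assms(3,4), of D]
      region_graph_trace_formulas[OF assms(5,6), of D]
    by (simp add: Let_def CWR2_diagram_def CWR3_diagram_def black_simple_graph_def
        white_simple_graph_def black_graph_def white_graph_def)
qed

end
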